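(* Let $X$ be a Banach space with a $\mathrm{Fin}$-Schauder basis. The following are equivalent for any ideals $\mathcal{I}$ and $\mathcal{J}$ on $\omega$: (a) there is an $\mathcal{I}$-Schauder basis of $X$ which is not a $\mathcal{J}$-Schauder basis of $X$; (b) $\mathcal{I}\not\subseteq\mathcal{J}$. In particular, if $\mathcal{I}\neq\mathrm{Fin}$, then there is an $\mathcal{I}$-Schauder basis of $X$ which is not a $\mathrm{Fin}$-Schauder basis of $X$.
   Context: $\omega=\{0,1,2,\dots\}$. An ideal on $\omega$ is a family $\mathcal{I}\subseteq\mathcal{P}(\omega)$ containing all finite sets and closed under subsets and finite unions. $\mathrm{Fin}$ is the ideal of finite subsets of $\omega$. Let $\mathbb{K}\in\{\mathbb{R},\mathbb{C}\}$ be the scalar field. All sequences of pairs $\hat{a}=(a_n,a_n^\star)_{n\in\omega}$ with $a_n\in X$, $a_n^\star:X\to\mathbb{K}$ are assumed biorthogonal: $a_n^\star(a_m)=\delta_{nm}$. Put $S_n(\hat{a})(x)=\sum_{i=0}^n a_i^\star(x)a_i$. For an ideal $\mathcal{I}$ on $\omega$, $\hat{a}$ is an $\mathcal{I}$-Schauder basis of $X$ if $\{n\in\omega:\|x-S_n(\hat{a})(x)\|_X\ge\varepsilon\}\in\mathcal{I}$ for all $x\in X$, $\varepsilon>0$. The assumption that $X$ has a $\mathrm{Fin}$-Schauder basis means that $X$ has a usual Schauder basis (with its continuous coordinate functionals). *)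

theory Defs
  imports "HOL-Analysis.Analysis"
begin

text \<open>
  The real and the complex case are treated together: the scalar field is a type of class
  \<open>{real_normed_field, banach}\<close>, of which \<open>real\<close> and \<open>complex\<close> are instances (and, up to isometric
  isomorphism, the only ones, by Gelfand--Mazur). As there is no class of complex vector
  spaces, the scalar multiplication is passed explicitly. Completeness of the space comes from the
  class \<open>banach\<close>; the real structure carried by that class is the restriction of the given one.
\<close>

locale banach_space_over = vector_space smul
  for smul :: "'k::{real_normed_field,banach} \<Rightarrow> 'a::banach \<Rightarrow> 'a" +
  assumes norm_smul: "norm (smul c x) = norm c * norm x"
    and smul_of_real: "smul (of_real r) x = r *\<^sub>R x"

lemma banach_space_over_scaleR:
  "banach_space_over (scaleR :: real \<Rightarrow> 'a::banach \<Rightarrow> 'a)"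
  by unfold_locales (simp_all add: algebra_simps)

lemma banach_space_over_complex: "banach_space_over ((*) :: complex \<Rightarrow> complex \<Rightarrow> complex)"
  by unfold_locales (simp_all add: algebra_simps norm_mult scaleR_conv_of_real)

definition continuous_functional ::
  "('k::{real_normed_field,banach} \<Rightarrow> 'a::banach \<Rightarrow> 'a) \<Rightarrow> ('a \<Rightarrow> 'k) \<Rightarrow> bool" where
  "continuous_functional smul f \<longleftrightarrow> Vector_Spaces.linear smul (*) f \<and> continuous_on UNIV f"

text \<open>Ideals need not be proper: the power set of \<open>\<nat>\<close> is an ideal.\<close>

definition ideal_on_nat :: "nat set set \<Rightarrow> bool" where
  "ideal_on_nat \<I> \<longleftrightarrow>
     (\<forall>A. finite A \<longrightarrow> A \<in> \<I>) \<and>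
     (\<forall>A B. A \<in> \<I> \<longrightarrow> B \<subseteq> A \<longrightarrow> B \<in> \<I>) \<and>
     (\<forall>A B. A \<in> \<I> \<longrightarrow> B \<in> \<I> \<longrightarrow> A \<union> B \<in> \<I>)"

definition Fin :: "nat set set" where
  "Fin = {A. finite A}"

lemma ideal_on_nat_Fin: "ideal_on_nat Fin"
  by (auto simp: ideal_on_nat_def Fin_def intro: finite_subset)

definition biorthogonal :: "(nat \<Rightarrow> 'a) \<Rightarrow> (nat \<Rightarrow> 'a \<Rightarrow> 'k::zero_neq_one) \<Rightarrow> bool" where
  "biorthogonal a astar \<longleftrightarrow> (\<forall>n m. astar n (a m) = (if n = m then 1 else 0))"

definition partial_sum ::
  "('k \<Rightarrow> 'a::comm_monoid_add \<Rightarrow> 'a) \<Rightarrow> (nat \<Rightarrow> 'a) \<Rightarrow> (nat \<Rightarrow> 'a \<Rightarrow> 'k) \<Rightarrow> nat \<Rightarrow> 'a \<Rightarrow> 'a" where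
  "partial_sum smul a astar n x = (\<Sum>i=0..n. smul (astar i x) (a i))"

text \<open>
  No linearity or continuity of the coordinate maps \<open>astar n\<close> is built in; where these are wanted,
  they are imposed separately through \<^const>\<open>continuous_functional\<close>.
\<close>

definition ideal_schauder_basis ::
  "('k::{real_normed_field,banach} \<Rightarrow> 'a::banach \<Rightarrow> 'a) \<Rightarrow> nat set set \<Rightarrow>
   (nat \<Rightarrow> 'a) \<Rightarrow> (nat \<Rightarrow> 'a \<Rightarrow> 'k) \<Rightarrow> bool" where
  "ideal_schauder_basis smul \<I> a astar \<longleftrightarrow>
     biorthogonal a astar \<and>
     (\<forall>x. \<forall>\<epsilon>>0. {n. norm (x - partial_sum smul a astar n x) \<ge> \<epsilon>} \<in> \<I>)"

text \<open>
  A Schauder basis in the usual sense. Continuity has to be demanded here: for arbitrary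
  coordinate maps, norm convergence of the partial sums does not make expansions unique.
\<close>

definition schauder_basis ::
  "('k::{real_normed_field,banach} \<Rightarrow> 'a::banach \<Rightarrow> 'a) \<Rightarrow>
   (nat \<Rightarrow> 'a) \<Rightarrow> (nat \<Rightarrow> 'a \<Rightarrow> 'k) \<Rightarrow> bool" where
  "schauder_basis smul e estar \<longleftrightarrow>
     ideal_schauder_basis smul Fin e estar \<and> (\<forall>n. continuous_functional smul (estar n))"

end

theory Submission imports Defs begin

text \<open>
  Let \<open>A\<close> be in \<open>\<I>\<close> but not in \<open>\<J>\<close>. If the complement of \<open>A\<close> is infinite, each maximal interval
  \<open>{p..<r}\<close> of \<open>A\<close> is followed by some \<open>r \<notin> A\<close>. Replacing \<open>e r\<close> by \<open>e r - \<lambda> e p\<close> and \<open>estar p\<close> by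
  \<open>estar p + \<lambda> estar r\<close> leaves the partial sums at indices outside \<open>A\<close> unchanged, and adds
  \<open>\<lambda> estar r x e p\<close> to those with index in \<open>{p..<r}\<close>. Hence the new system is an \<open>\<I>\<close>-basis for
  every choice of the numbers \<open>\<lambda>\<close>. For an \<open>x\<close> all of whose coordinates are nonzero, they can be
  chosen to make the added terms unit vectors, so that the partial sums of \<open>x\<close> stay away from \<open>x\<close>
  along \<open>A\<close>. If the complement of \<open>A\<close> is finite, then every biorthogonal system is an \<open>\<I>\<close>-basis,
  and omitting the first basis vector yields one that is not a \<open>\<J>\<close>-basis.
\<close>

section \<open>Convergence along ideals\<close>

lemma ideal_schauder_basis_mono:
  assumes "ideal_schauder_basis smul \<I> a astar" "\<I> \<subseteq> \<J>"
  shows "ideal_schauder_basis smul \<J> a astar"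
  using assms unfolding ideal_schauder_basis_def by blast

lemma ideal_schauder_basis_Fin_imp_tendsto:
  assumes "ideal_schauder_basis smul Fin a astar"
  shows "(\<lambda>n. partial_sum smul a astar n x) \<longlonglongrightarrow> x"
proof (rule tendstoI)
  fix \<epsilon> :: real assume "\<epsilon> > 0"
  then have "finite {n. norm (x - partial_sum smul a astar n x) \<ge> \<epsilon>}"
    using assms unfolding ideal_schauder_basis_def Fin_def by blast
  then have "\<forall>\<^sub>F n in sequentially. \<not> norm (x - partial_sum smul a astar n x) \<ge> \<epsilon>"
    by (simp add: cofinite_eq_sequentially [symmetric] eventually_cofinite)
  then show "\<forall>\<^sub>F n in sequentially. dist (partial_sum smul a astar n x) x < \<epsilon>"
    by eventually_elim (simp add: dist_norm norm_minus_commute)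
qed

section \<open>Maximal intervals (blocks) of a set of natural numbers\<close>

text \<open>The least \<open>p \<le> n\<close> with \<open>{p..<n} \<subseteq> A\<close>.\<close>

fun block_start :: "nat set \<Rightarrow> nat \<Rightarrow> nat" where
  "block_start A 0 = 0"
| "block_start A (Suc n) = (if n \<in> A then block_start A n else Suc n)"

text \<open>A genuine minimum whenever the complement of \<open>A\<close> is infinite; otherwise the
  value may be unspecified.\<close>

definition block_end :: "nat set \<Rightarrow> nat \<Rightarrow> nat" where
  "block_end A n = (LEAST m. n \<le> m \<and> m \<notin> A)"

lemma block_start_le: "block_start A n \<le> n"
  by (induction n) auto

lemma block_start_idem: "block_start A (block_start A n) = block_start A n"
  by (induction n) auto

lemma atLeastLessThan_block_start_subset: "{block_start A n..<n} \<subseteq> A"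
  by (induction n) (auto simp: less_Suc_eq)

lemma block_start_in: "block_start A n \<noteq> n \<Longrightarrow> block_start A n \<in> A"
  using atLeastLessThan_block_start_subset[of A n] block_start_le[of A n] by fastforce

lemma block_start_eq:
  assumes "n \<le> m" "{n..<m} \<subseteq> A"
  shows "block_start A m = block_start A n"
  using assms by (induction m rule: dec_induct) (auto simp: atLeastLessThanSuc)

lemma block_end_eq:
  assumes "n \<le> m" "m \<notin> A" "{n..<m} \<subseteq> A"
  shows "block_end A n = m"
  unfolding block_end_def
proof (rule Least_equality)
  fix k assume "n \<le> k \<and> k \<notin> A"
  then show "m \<le> k" using assms(3) by (meson atLeastLessThan_iff not_le subsetD)
qed (use assms in auto)

text \<open>The two predicates under \<open>LEAST\<close> coincide, so the equation does not depend
  on a minimum being attained.\<close>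

lemma block_end_Suc:
  assumes "n \<in> A"
  shows "block_end A (Suc n) = block_end A n"
proof -
  have "(Suc n \<le> m \<and> m \<notin> A) = (n \<le> m \<and> m \<notin> A)" for m
    using assms by (metis Suc_leD le_eq_less_or_eq less_eq_Suc_le)
  then show ?thesis by (simp add: block_end_def)
qed

lemma block_end_block_start: "block_end A (block_start A n) = block_end A n"
  by (induction n) (auto simp: block_end_Suc)

context
  fixes A :: "nat set"
  assumes infinite_compl: "infinite (- A)"
begin

lemma block_end: "n \<le> block_end A n" "block_end A n \<notin> A"
proof -
  obtain m where "n \<le> m \<and> m \<notin> A"
    using infinite_compl unfolding infinite_nat_iff_unbounded_le by auto
  then have "n \<le> block_end A n \<and> block_end A n \<notin> A"
    unfolding block_end_def by (rule LeastI)
  then show "n \<le> block_end A n" "block_end A n \<notin> A" by auto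
qed

lemma atLeastLessThan_block_end_subset: "{n..<block_end A n} \<subseteq> A"
  unfolding block_end_def using not_less_Least by fastforce

lemma block_start_block_end: "block_start A (block_end A n) = block_start A n"
  by (intro block_start_eq block_end atLeastLessThan_block_end_subset)

end

section \<open>Coordinate functionals of a Schauder basis\<close>

lemma (in banach_space_over) continuous_functional_add_mult:
  assumes "continuous_functional smul f" "continuous_functional smul g"
  shows "continuous_functional smul (\<lambda>x. f x + c * g x)"
proof -
  have *: "Vector_Spaces.linear smul (*) f" "Vector_Spaces.linear smul (*) g"
    using assms by (auto simp: continuous_functional_def)
  have "Vector_Spaces.linear smul (*) (\<lambda>x. f x + c * g x)"
    using * unfolding Vector_Spaces.linear_iff by (auto simp: algebra_simps)
  then show ?thesis
    using assms by (auto simp: continuous_functional_def intro!: continuous_intros)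
qed

locale schauder_space = banach_space_over smul
  for smul :: "'k::{real_normed_field,banach} \<Rightarrow> 'a::banach \<Rightarrow> 'a" +
  fixes e :: "nat \<Rightarrow> 'a" and estar :: "nat \<Rightarrow> 'a \<Rightarrow> 'k"
  assumes schauder: "schauder_basis smul e estar"
begin

lemma continuous_functional_estar: "continuous_functional smul (estar n)"
  using schauder by (auto simp: schauder_basis_def)

lemma linear_estar: "Vector_Spaces.linear smul (*) (estar n)"
  using continuous_functional_estar by (auto simp: continuous_functional_def)

lemmas module_hom_estar = Vector_Spaces.linear.axioms(3)[OF linear_estar]

lemmas estar_linear_simps =
  module_hom.diff[OF module_hom_estar] module_hom.scale[OF module_hom_estar]
  module_hom.sum[OF module_hom_estar]

lemma estar_e [simp]: "estar n (e m) = (if n = m then 1 else 0)"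
  using schauder by (auto simp: schauder_basis_def ideal_schauder_basis_def biorthogonal_def)

lemma e_nonzero [simp]: "e n \<noteq> 0"
  using module_hom.zero[OF module_hom_estar, of n] estar_e[of n n] by force

lemma tendsto_partial_sum: "(\<lambda>n. partial_sum smul e estar n x) \<longlonglongrightarrow> x"
  using schauder unfolding schauder_basis_def by (blast intro: ideal_schauder_basis_Fin_imp_tendsto)

text \<open>Dividing by \<open>norm (e n)\<close> gives a series dominated by a geometric one.
  Continuity of \<open>estar n\<close> lets the coordinates of its sum be read off the finite sums,
  where they are eventually constant.\<close>

lemma exists_nonzero_coordinates: "\<exists>x. \<forall>n. estar n x \<noteq> 0"
proof -
  define c :: "nat \<Rightarrow> 'k" where "c n = of_real ((1/2) ^ n / norm (e n))" for n
  define x where "x = (\<Sum>n. smul (c n) (e n))"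
  have "norm (smul (c n) (e n)) = (1/2) ^ n" for n
    by (simp add: norm_smul c_def norm_divide norm_power)
  then have "summable (\<lambda>n. norm (smul (c n) (e n)))"
    by (simp only:) (rule summable_geometric, simp)
  then have "(\<lambda>n. smul (c n) (e n)) sums x"
    unfolding x_def by (rule summable_sums[OF summable_norm_cancel])
  then have lim: "(\<lambda>N. \<Sum>i<N. smul (c i) (e i)) \<longlonglongrightarrow> x"
    by (simp add: sums_def)
  have "estar n x = c n" for n
  proof (rule LIMSEQ_unique)
    have "isCont (estar n) x"
      using continuous_functional_estar
      by (simp add: continuous_functional_def continuous_on_eq_continuous_at)
    then show "(\<lambda>N. estar n (\<Sum>i<N. smul (c i) (e i))) \<longlonglongrightarrow> estar n x"
      using lim by (rule isCont_tendsto_compose)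
    have "estar n (\<Sum>i<N. smul (c i) (e i)) = c n" if "N > n" for N
      using that by (simp add: estar_linear_simps if_distrib[of "(*) _"] cong: if_cong)
    then show "(\<lambda>N. estar n (\<Sum>i<N. smul (c i) (e i))) \<longlonglongrightarrow> c n"
      by (intro tendsto_eventually eventually_sequentiallyI[of "Suc n"]) simp
  qed
  moreover have "c n \<noteq> 0" for n by (simp add: c_def)
  ultimately show ?thesis by metis
qed

section \<open>The system twisted along the blocks\<close>

definition twist_vec :: "nat set \<Rightarrow> (nat \<Rightarrow> 'k) \<Rightarrow> nat \<Rightarrow> 'a" where
  "twist_vec A l n =
     (if n \<notin> A \<and> block_start A n \<noteq> n
      then e n - smul (l (block_start A n)) (e (block_start A n)) else e n)"

text \<open>The condition selects the first element of a block; the one in \<open>twist_vec\<close>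
  selects an index directly after a block, since \<open>block_start A n \<noteq> n\<close> means
  that \<open>n - 1\<close> lies in \<open>A\<close>.\<close>

definition twist_fun :: "nat set \<Rightarrow> (nat \<Rightarrow> 'k) \<Rightarrow> nat \<Rightarrow> 'a \<Rightarrow> 'k" where
  "twist_fun A l n =
     (if n \<in> A \<and> block_start A n = n
      then (\<lambda>x. estar n x + l n * estar (block_end A n) x) else estar n)"

lemma continuous_functional_twist_fun: "continuous_functional smul (twist_fun A l n)"
  by (simp add: twist_fun_def continuous_functional_estar continuous_functional_add_mult)

text \<open>The critical pair is the functional at the start \<open>p\<close> of a block and the
  vector at the index \<open>r\<close> after it: \<open>estar p\<close> contributes
  \<open>- l p\<close>, and \<open>l p * estar r\<close> contributes \<open>l p\<close>.\<close>

lemma biorthogonal_twist: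
  assumes "infinite (- A)"
  shows "biorthogonal (twist_vec A l) (twist_fun A l)"
  unfolding biorthogonal_def
proof (intro allI)
  fix n m
  note E = block_end[OF assms, of n] block_start_block_end[OF assms, of n]
  show "twist_fun A l n (twist_vec A l m) = (if n = m then 1 else 0)"
  proof (cases "n \<in> A \<and> block_start A n = n")
    case n: True
    show ?thesis
    proof (cases "m \<notin> A \<and> block_start A m \<noteq> m")
      case m: True
      \<comment> \<open>\<open>block_start\<close> and \<open>block_end\<close> are mutually inverse
        between first elements of blocks and indices directly after blocks.\<close>
      have "n \<noteq> m" "block_end A n \<noteq> block_start A m" "block_end A n = m \<longleftrightarrow> n = block_start A m"
        using n m E block_start_in[of A m] block_end_block_start[of A m]
          block_end_eq[of m m A] by auto
      then show ?thesis
        using n m by (auto simp: twist_fun_def twist_vec_def estar_linear_simps)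
    next
      case False
      then have "block_end A n \<noteq> m" using n E by auto
      then show ?thesis using n False by (auto simp: twist_fun_def twist_vec_def)
    qed
  next
    case False
    \<comment> \<open>Subtracted vectors have indices that start a block, so an unchanged functional
      does not see them.\<close>
    then have "m \<notin> A \<and> block_start A m \<noteq> m \<longrightarrow> n \<noteq> block_start A m"
      using block_start_in[of A m] block_start_idem[of A m] by auto
    then show ?thesis
      using False by (auto simp: twist_fun_def twist_vec_def estar_linear_simps)
  qed
qed

text \<open>The extra term enters with the functional at the start of a block, persists while the
  index stays in the block, and is cancelled by the vector directly after it.\<close>

lemma partial_sum_twist:
  "partial_sum smul (twist_vec A l) (twist_fun A l) n x =
   partial_sum smul e estar n x +
     (if n \<in> A then smul (l (block_start A n) * estar (block_end A n) x) (e (block_start A n)) else 0)"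
proof (induction n)
  case 0
  show ?case by (simp add: partial_sum_def twist_vec_def twist_fun_def scale_left_distrib)
next
  case (Suc n)
  have step: "partial_sum smul a astar (Suc n) x =
      partial_sum smul a astar n x + smul (astar (Suc n) x) (a (Suc n))"
    for a and astar :: "nat \<Rightarrow> 'a \<Rightarrow> 'k"
    by (simp add: partial_sum_def)
  have "block_start A n \<noteq> Suc n" using block_start_le[of A n] by auto
  moreover have "block_end A n = Suc n" if "n \<in> A" "Suc n \<notin> A"
    using that by (intro block_end_eq) auto
  ultimately show ?case
    unfolding step Suc.IH
    by (auto simp: twist_vec_def twist_fun_def block_end_Suc scale_left_distrib
        scale_right_diff_distrib mult.commute)
qed

text \<open>Outside \<open>A\<close> the partial sums are the old ones, so each exceptional set lies
  in \<open>A\<close> together with a finite set.\<close>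

lemma ideal_schauder_basis_twist:
  assumes "ideal_on_nat \<I>" "A \<in> \<I>" "infinite (- A)"
  shows "ideal_schauder_basis smul \<I> (twist_vec A l) (twist_fun A l)"
  unfolding ideal_schauder_basis_def
proof (intro conjI allI impI biorthogonal_twist assms)
  fix x and \<epsilon> :: real assume "\<epsilon> > 0"
  let ?B = "{n. norm (x - partial_sum smul e estar n x) \<ge> \<epsilon>}"
  have "finite ?B"
    using schauder \<open>\<epsilon> > 0\<close>
    unfolding schauder_basis_def ideal_schauder_basis_def Fin_def by blast
  then have "A \<union> ?B \<in> \<I>" using assms by (auto simp: ideal_on_nat_def)
  moreover have "{n. norm (x - partial_sum smul (twist_vec A l) (twist_fun A l) n x) \<ge> \<epsilon>} \<subseteq> A \<union> ?B"
    by (auto simp: partial_sum_twist)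
  ultimately show "{n. norm (x - partial_sum smul (twist_vec A l) (twist_fun A l) n x) \<ge> \<epsilon>} \<in> \<I>"
    using assms(1) unfolding ideal_on_nat_def by blast
qed

lemma exists_not_ideal_schauder_basis_twist:
  assumes "ideal_on_nat \<J>" "A \<notin> \<J>"
  shows "\<exists>l. \<not> ideal_schauder_basis smul \<J> (twist_vec A l) (twist_fun A l)"
proof -
  obtain x where x: "\<And>n. estar n x \<noteq> 0" using exists_nonzero_coordinates by blast
  \<comment> \<open>This makes the extra term at each index in \<open>A\<close> a scalar of modulus
    \<open>1 / norm (e p)\<close> times \<open>e p\<close>, where \<open>p\<close> starts the
    block.\<close>
  define l where "l n = of_real (1 / norm (e n)) / estar (block_end A n) x" for n
  let ?S = "partial_sum smul e estar" and ?T = "partial_sum smul (twist_vec A l) (twist_fun A l)"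
  have T: "norm (?T n x - ?S n x) = 1" if "n \<in> A" for n
    using that x
    by (simp add: partial_sum_twist l_def block_end_block_start norm_smul norm_divide)
  \<comment> \<open>Half of the distance 1 between the two sums: once \<open>?S n x\<close> is
    closer than 1/2 to \<open>x\<close>, \<open>?T n x\<close> cannot be.\<close>
  let ?C = "{n. norm (x - ?T n x) \<ge> 1/2}"
  have "\<forall>\<^sub>F n in sequentially. dist (?S n x) x < 1/2"
    using tendsto_partial_sum by (rule tendstoD) simp
  then obtain N where N: "\<And>n. n \<ge> N \<Longrightarrow> norm (x - ?S n x) < 1/2"
    unfolding eventually_sequentially by (auto simp: dist_norm norm_minus_commute)
  have "A \<subseteq> {..<N} \<union> ?C"
  proof
    fix n assume "n \<in> A"
    have "norm (?T n x - ?S n x) \<le> norm (x - ?S n x) + norm (x - ?T n x)"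
      using norm_triangle_ineq4[of "x - ?S n x" "x - ?T n x"] by simp
    then show "n \<in> {..<N} \<union> ?C"
      using T[OF \<open>n \<in> A\<close>] N[of n] by (cases "n < N") auto
  qed
  then have "{..<N} \<union> ?C \<notin> \<J>" using assms unfolding ideal_on_nat_def by blast
  then have "?C \<notin> \<J>" using assms(1) unfolding ideal_on_nat_def by blast
  then have "\<not> ideal_schauder_basis smul \<J> (twist_vec A l) (twist_fun A l)"
    unfolding ideal_schauder_basis_def by (metis half_gt_zero_iff zero_less_one)
  then show ?thesis by blast
qed

text \<open>Here \<I> is the whole power set, so only biorthogonality matters. All shifted
  coordinates of \<open>e 0\<close> vanish, so its partial sums stay at distance
  \<open>norm (e 0)\<close>.\<close>

lemma ideal_schauder_basis_shift:
  assumes "ideal_on_nat \<I>" "ideal_on_nat \<J>" "UNIV \<in> \<I>" "UNIV \<notin> \<J>"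
  shows "ideal_schauder_basis smul \<I> (\<lambda>n. e (Suc n)) (\<lambda>n. estar (Suc n))"
    and "\<not> ideal_schauder_basis smul \<J> (\<lambda>n. e (Suc n)) (\<lambda>n. estar (Suc n))"
proof -
  have "B \<in> \<I>" for B using assms(1,3) unfolding ideal_on_nat_def by blast
  then show "ideal_schauder_basis smul \<I> (\<lambda>n. e (Suc n)) (\<lambda>n. estar (Suc n))"
    by (simp add: ideal_schauder_basis_def biorthogonal_def)
  have "{n. norm (e 0 - partial_sum smul (\<lambda>n. e (Suc n)) (\<lambda>n. estar (Suc n)) n (e 0)) \<ge> norm (e 0)}
      = UNIV"
    by (simp add: partial_sum_def)
  then show "\<not> ideal_schauder_basis smul \<J> (\<lambda>n. e (Suc n)) (\<lambda>n. estar (Suc n))"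
    using assms(4) unfolding ideal_schauder_basis_def by (metis e_nonzero zero_less_norm_iff)
qed

section \<open>Separating two ideals\<close>

lemma exists_separating_basis:
  assumes "ideal_on_nat \<I>" "ideal_on_nat \<J>" "\<not> \<I> \<subseteq> \<J>"
  shows "\<exists>a astar. (\<forall>n. continuous_functional smul (astar n)) \<and>
    ideal_schauder_basis smul \<I> a astar \<and> \<not> ideal_schauder_basis smul \<J> a astar"
proof -
  obtain A where A: "A \<in> \<I>" "A \<notin> \<J>" using assms(3) by blast
  show ?thesis
  proof (cases "finite (- A)")
    case True
    then have "A \<union> - A \<in> \<I>" using assms(1) A(1) unfolding ideal_on_nat_def by blast
    then have "UNIV \<in> \<I>" by simp
    moreover have "UNIV \<notin> \<J>" using assms(2) A(2) unfolding ideal_on_nat_def by blast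
    ultimately show ?thesis
      using ideal_schauder_basis_shift[OF assms(1,2)] continuous_functional_estar
      by (intro exI[of _ "\<lambda>n. e (Suc n)"] exI[of _ "\<lambda>n. estar (Suc n)"]) simp
  next
    case False
    then show ?thesis
      using ideal_schauder_basis_twist[OF assms(1) A(1)] continuous_functional_twist_fun
        exists_not_ideal_schauder_basis_twist[OF assms(2) A(2)] by blast
  qed
qed

end

theorem corollary4p2:
  fixes smul :: "'k::{real_normed_field,banach} \<Rightarrow> 'a::banach \<Rightarrow> 'a"
    and \<I> \<J> :: "nat set set"
  assumes "banach_space_over smul"
    and "\<exists>e estar. schauder_basis smul e estar"
    and "ideal_on_nat \<I>" and "ideal_on_nat \<J>"
  shows
    "((\<exists>a astar. ideal_schauder_basis smul \<I> a astar \<and> \<not> ideal_schauder_basis smul \<J> a astar)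
        \<longleftrightarrow> \<not> \<I> \<subseteq> \<J>) \<and>
     ((\<exists>a astar. (\<forall>n. continuous_functional smul (astar n)) \<and>
          ideal_schauder_basis smul \<I> a astar \<and> \<not> ideal_schauder_basis smul \<J> a astar)
        \<longleftrightarrow> \<not> \<I> \<subseteq> \<J>) \<and>
     (\<I> \<noteq> Fin \<longrightarrow>
        (\<exists>a astar. (\<forall>n. continuous_functional smul (astar n)) \<and>
          ideal_schauder_basis smul \<I> a astar \<and> \<not> ideal_schauder_basis smul Fin a astar))"
proof -
  obtain e estar where "schauder_basis smul e estar" using assms(2) by blast
  then interpret schauder_space smul e estar
    using assms(1) by (simp add: schauder_space_def schauder_space_axioms_def)
  \<comment> \<open>\<open>Fin\<close> is the least ideal, so inclusion in it would force
    equality.\<close>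
  have "\<not> \<I> \<subseteq> Fin" if "\<I> \<noteq> Fin"
    using that assms(3) by (auto simp: ideal_on_nat_def Fin_def)
  \<comment> \<open>The basis with continuous functionals serves both equivalences; their converses
    are monotonicity in the ideal. The last claim is the case \<J> = \<open>Fin\<close>.\<close>
  then show ?thesis
    using exists_separating_basis[OF assms(3,4)] exists_separating_basis[OF assms(3) ideal_on_nat_Fin]
      ideal_schauder_basis_mono[of smul \<I> _ _ \<J>]
    by blast
qed

end
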